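(* Let $\mathcal{H}$ be a separable Hilbert space, let $W$ be a closed subspace of $\mathcal{H}$, let $P_W$ be the orthogonal projection onto $W$, and let $\mathcal{G}=\{g_j\}_{j\ge1}$ be a Bessel sequence in $\mathcal{H}$. Let $A$ be a bounded linear operator on $\mathcal{H}$ with spectral radius $\rho(A)<1$, and consider the dynamical system $x_{n+1}=Ax_n+w$, $n\ge0$, with arbitrary initial state $x_0\in\mathcal{H}$ and source term $w\in W$. Then each source term $w\in W$ of the system can be recovered from the measurements $\mathcal{D}(x_0,w)=[\langle x_n,g_j\rangle]_{n\ge0,\,j\ge1}$ in a stable way if and only if $\{P_W(I-A^* )^{-1}g_j\}_{j\ge1}$ is a frame for $W$.
   Context: Hilbert spaces are complex; $I$ is the identity operator. A sequence $\{g_j\}_{j\ge1}$ in $\mathcal{H}$ is a Bessel sequence if there is $C<\infty$ with $\sum_{j}|\langle h,g_j\rangle|^2\le C\|h\|^2$ for all $h\in\mathcal{H}$. A sequence $\{f_j\}_{j\ge1}\subset W$ is a frame for $W$ if there are constants $0<c\le C<\infty$ with $c\|w\|^2\le\sum_j|\langle w,f_j\rangle|^2\le C\|w\|^2$ for all $w\in W$. The space $\mathcal{B}^{s}(\ell^2,\ell^\infty)$ is the set of infinite complex matrices whose rows $r_n$ belong to $\ell^2$ and for which there exists $t\in\ell^2$ with $\lim_{n\to\infty}\|r_n-t\|_{\ell^2}=0$, endowed with the norm $\sup_n\|r_n\|_{\ell^2}$. For data matrices of dynamical systems the rows are indexed by $n\ge0$ and the columns by $j\ge1$; the data matrices $\mathcal{D}(x_0,w)$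 of this system are regarded as elements of this space. Stable recovery (infinitely many iterations): the source term $w\in W$ can be recovered from $\mathcal{D}(x_0,w)$ in a stable way if there exists a bounded linear operator $\mathcal{R}:\mathcal{B}^s(\ell^2,\ell^\infty)\to\mathcal{H}$ such that $\mathcal{R}(\mathcal{D}(x_0,w))=w$ for all $x_0\in\mathcal{H}$ and all $w\in W$, where $(x_n)$ is the orbit of the system generated by $x_0$ and $w$. *)

theory Defs
  imports "HOL-Analysis.Analysis"
begin

section \<open>Complex Hilbert spaces\<close>

text \<open>
  A complex inner product space is presented as a real one (so that norm, topology and
  completeness are the library's) carrying a compatible complex scalar multiplication and a
  sesquilinear form whose real part is the real inner product. Every complex inner product space
  arises in this way. The form is linear in the \<^emph>\<open>first\<close> argument and conjugate linear in the
  second; positive definiteness and the relation to the norm are inherited from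
  \<^class>\<open>real_inner\<close>.
\<close>

class complex_inner = real_inner +
  fixes scaleC :: "complex \<Rightarrow> 'a \<Rightarrow> 'a"  (infixr \<open>*\<^sub>C\<close> 75)
    and cinner :: "'a \<Rightarrow> 'a \<Rightarrow> complex"
  assumes scaleC_add_right: "c *\<^sub>C (x + y) = c *\<^sub>C x + c *\<^sub>C y"
    and scaleC_add_left: "(c + d) *\<^sub>C x = c *\<^sub>C x + d *\<^sub>C x"
    and scaleC_scaleC: "c *\<^sub>C d *\<^sub>C x = (c * d) *\<^sub>C x"
    and scaleC_of_real: "complex_of_real r *\<^sub>C x = r *\<^sub>R x"
    and cinner_add_left: "cinner (x + y) z = cinner x z + cinner y z"
    and cinner_scaleC_left: "cinner (c *\<^sub>C x) y = c * cinner x y"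
    and cinner_commute: "cinner x y = cnj (cinner y x)"
    and Re_cinner: "Re (cinner x y) = inner x y"

class chilbert_space = complex_inner + complete_space

lemma cinner_self: "cinner x x = complex_of_real ((norm x)\<^sup>2)"
proof -
  have "Im (cinner x x) = 0"
    using arg_cong[OF cinner_commute[of x x], of Im] by simp
  then show ?thesis
    by (simp add: complex_eq_iff Re_cinner power2_norm_eq_inner)
qed

lemma vector_space_scaleC: "vector_space (scaleC :: complex \<Rightarrow> 'a \<Rightarrow> 'a::complex_inner)"
proof
  show "1 *\<^sub>C x = x" for x :: 'a
    using scaleC_of_real[of 1 x] by simp
qed (simp_all add: scaleC_add_right scaleC_add_left scaleC_scaleC)

instantiation complex :: chilbert_space
begin

definition scaleC_complex :: "complex \<Rightarrow> complex \<Rightarrow> complex" where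
  "scaleC_complex c x = c * x"

definition cinner_complex :: "complex \<Rightarrow> complex \<Rightarrow> complex" where
  "cinner_complex x y = x * cnj y"

instance
  by standard
    (simp_all add: scaleC_complex_def cinner_complex_def algebra_simps inner_complex_def
      scaleR_conv_of_real)

end


section \<open>Operators and subspaces\<close>

definition csubspace :: "'a::complex_inner set \<Rightarrow> bool" where
  "csubspace W \<longleftrightarrow> module.subspace scaleC W"

definition bounded_clinear :: "('a::complex_inner \<Rightarrow> 'b::complex_inner) \<Rightarrow> bool" where
  "bounded_clinear T \<longleftrightarrow>
     Vector_Spaces.linear scaleC scaleC T \<and> (\<exists>K. \<forall>x. norm (T x) \<le> K * norm x)"

definition cspectrum :: "('a::complex_inner \<Rightarrow> 'a) \<Rightarrow> complex set" where
  "cspectrum A = {c. \<not> (\<exists>B. bounded_clinear B \<and>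
      (\<forall>x. B (c *\<^sub>C x - A x) = x) \<and> (\<forall>x. c *\<^sub>C B x - A (B x) = x))}"

text \<open>
  The spectrum is empty precisely on the zero space; inserting \<open>0\<close> gives the spectral radius the
  value \<open>0\<close> there and changes nothing otherwise.
\<close>

definition spectral_radius :: "('a::complex_inner \<Rightarrow> 'a) \<Rightarrow> real" where
  "spectral_radius A = Sup (insert 0 (norm ` cspectrum A))"

definition cadjoint :: "('a::complex_inner \<Rightarrow> 'a) \<Rightarrow> 'a \<Rightarrow> 'a" where
  "cadjoint A = (THE B. \<forall>x y. cinner (A x) y = cinner x (B y))"

definition orth_proj :: "'a::complex_inner set \<Rightarrow> 'a \<Rightarrow> 'a" where
  "orth_proj W x = (THE p. p \<in> W \<and> (\<forall>v\<in>W. cinner (x - p) v = 0))"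


section \<open>Bessel sequences and frames\<close>

text \<open>
  Here and below, sequences indexed by \<open>j \<ge> 1\<close> are functions on \<^typ>\<open>nat\<close>, the term of index
  \<open>j + 1\<close> being the value at \<open>j\<close>.
\<close>

definition bessel_sequence :: "(nat \<Rightarrow> 'a::complex_inner) \<Rightarrow> bool" where
  "bessel_sequence g \<longleftrightarrow>
     (\<exists>C. \<forall>h. summable (\<lambda>j. (cmod (cinner h (g j)))\<^sup>2) \<and>
              (\<Sum>j. (cmod (cinner h (g j)))\<^sup>2) \<le> C * (norm h)\<^sup>2)"

definition frame_for :: "'a::complex_inner set \<Rightarrow> (nat \<Rightarrow> 'a) \<Rightarrow> bool" where
  "frame_for W f \<longleftrightarrow> range f \<subseteq> W \<and>
     (\<exists>c C. 0 < c \<and> c \<le> C \<and>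
       (\<forall>w\<in>W. summable (\<lambda>j. (cmod (cinner w (f j)))\<^sup>2) \<and>
          c * (norm w)\<^sup>2 \<le> (\<Sum>j. (cmod (cinner w (f j)))\<^sup>2) \<and>
          (\<Sum>j. (cmod (cinner w (f j)))\<^sup>2) \<le> C * (norm w)\<^sup>2))"


section \<open>The space of data matrices\<close>

definition ell2 :: "(nat \<Rightarrow> complex) set" where
  "ell2 = {a. summable (\<lambda>j. (cmod (a j))\<^sup>2)}"

definition ell2_norm :: "(nat \<Rightarrow> complex) \<Rightarrow> real" where
  "ell2_norm a = sqrt (\<Sum>j. (cmod (a j))\<^sup>2)"

text \<open>The space \<open>B\<^sup>s(\<ell>\<^sup>2, \<ell>\<^sup>\<infinity>)\<close>; the first index of a matrix is its row.\<close>

definition Bs_space :: "(nat \<Rightarrow> nat \<Rightarrow> complex) set" where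
  "Bs_space = {M. (\<forall>n. M n \<in> ell2) \<and>
     (\<exists>t\<in>ell2. (\<lambda>n. ell2_norm (\<lambda>j. M n j - t j)) \<longlonglongrightarrow> 0)}"

definition Bs_norm :: "(nat \<Rightarrow> nat \<Rightarrow> complex) \<Rightarrow> real" where
  "Bs_norm M = (SUP n. ell2_norm (M n))"

text \<open>Only the values on \<^const>\<open>Bs_space\<close> matter.\<close>

definition bounded_clinear_Bs :: "((nat \<Rightarrow> nat \<Rightarrow> complex) \<Rightarrow> 'a::complex_inner) \<Rightarrow> bool" where
  "bounded_clinear_Bs R \<longleftrightarrow>
     (\<forall>M\<in>Bs_space. \<forall>N\<in>Bs_space. R (\<lambda>n j. M n j + N n j) = R M + R N) \<and>
     (\<forall>c. \<forall>M\<in>Bs_space. R (\<lambda>n j. c * M n j) = c *\<^sub>C R M) \<and>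
     (\<exists>K. \<forall>M\<in>Bs_space. norm (R M) \<le> K * Bs_norm M)"


section \<open>The dynamical system and stable recovery\<close>

primrec orbit :: "('a::complex_inner \<Rightarrow> 'a) \<Rightarrow> 'a \<Rightarrow> 'a \<Rightarrow> nat \<Rightarrow> 'a" where
  "orbit A x0 w 0 = x0"
| "orbit A x0 w (Suc n) = A (orbit A x0 w n) + w"

definition data_matrix ::
  "('a::complex_inner \<Rightarrow> 'a) \<Rightarrow> (nat \<Rightarrow> 'a) \<Rightarrow> 'a \<Rightarrow> 'a \<Rightarrow> nat \<Rightarrow> nat \<Rightarrow> complex" where
  "data_matrix A g x0 w = (\<lambda>n j. cinner (orbit A x0 w n) (g j))"

text \<open>
  Since operators on \<^const>\<open>Bs_space\<close> are total functions here, membership of the data matrices in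
  their domain is stated explicitly.
\<close>

definition stably_recoverable ::
  "('a::complex_inner \<Rightarrow> 'a) \<Rightarrow> (nat \<Rightarrow> 'a) \<Rightarrow> 'a set \<Rightarrow> bool" where
  "stably_recoverable A g W \<longleftrightarrow>
     (\<exists>R :: (nat \<Rightarrow> nat \<Rightarrow> complex) \<Rightarrow> 'a. bounded_clinear_Bs R \<and>
        (\<forall>x0. \<forall>w\<in>W. data_matrix A g x0 w \<in> Bs_space \<and> R (data_matrix A g x0 w) = w))"

end

theory Submission
  imports Defs "HOL-Complex_Analysis.Cauchy_Integral_Formula"
begin

text \<open>
  Write \<open>F = (I - A)\<^sup>-\<^sup>1\<close>, \<open>T w = (\<langle>F w, g\<^sub>j\<rangle>)\<^sub>j\<close> and \<open>f\<^sub>j = P\<^sub>W (I - A\<^sup>*)\<^sup>-\<^sup>1 g\<^sub>j\<close>. Moving operators across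
  the inner product gives \<open>\<langle>w, f\<^sub>j\<rangle> = \<langle>F w, g\<^sub>j\<rangle>\<close> for \<open>w \<in> W\<close>. The Bessel property makes
  \<open>T\<close> bounded into \<open>\<ell>\<^sup>2\<close>, so \<open>{f\<^sub>j}\<close> is a frame for \<open>W\<close> exactly if \<open>T\<close> is bounded below on \<open>W\<close>
  (\<open>frame_for_iff_lower_bound\<close>). The theorem thus says that stable recovery amounts to a lower
  bound for \<open>T\<close> on \<open>W\<close>.

  Stable recovery gives the lower bound because the initial state may be chosen as the fixed point
  \<open>F w\<close>: the data matrix then has all its rows equal to \<open>T w\<close>, and its norm is \<open>\<parallel>T w\<parallel>\<close>
  (\<open>stably_recoverable_imp_lower_bound\<close>).

  Conversely, every orbit with source \<open>w\<close> converges to \<open>F w\<close>, since \<open>x\<^sub>n - F w = A\<^sup>n (x\<^sub>0 - F w)\<close> and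
  the powers of \<open>A\<close> tend to zero pointwise (\<open>powers_tendsto_zero\<close>). So the rows of the data matrix
  converge to \<open>T w\<close> whatever the initial state, and recovery is the row limit followed by a bounded
  left inverse of \<open>T\<close>, which least squares provides (\<open>bounded_below_imp_left_inverse\<close>).

  The two analytic ingredients are a variational principle and Cauchy's inequality. The principle,
  \<open>coercive_form_representation\<close>, represents functionals by coercive forms and yields adjoints,
  orthogonal projections and least squares solutions alike. Cauchy's inequality is applied to the
  scalar functions \<open>z \<mapsto> \<langle>(I - z A)\<^sup>-\<^sup>1 x, y\<rangle>\<close>, which are holomorphic on a disc of radius greater
  than one and have Taylor coefficients \<open>\<langle>A\<^sup>n x, y\<rangle>\<close>.
\<close>


section \<open>Complex inner products and complex linear operators\<close>

lemma scaleC_one [simp]: "1 *\<^sub>C x = (x :: 'a::complex_inner)"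
  using scaleC_of_real[of 1 x] by simp

lemma zero_scaleC [simp]: "0 *\<^sub>C x = (0 :: 'a::complex_inner)"
  using scaleC_add_left[of 0 0 x] by simp

lemma scaleC_diff_right: "c *\<^sub>C (x - y) = c *\<^sub>C x - c *\<^sub>C (y :: 'a::complex_inner)"
  using scaleC_add_right[of c "x - y" y] by (simp add: algebra_simps)

lemma scaleC_diff_left: "(c - d) *\<^sub>C x = c *\<^sub>C x - d *\<^sub>C (x :: 'a::complex_inner)"
  using scaleC_add_left[of "c - d" d x] by (simp add: algebra_simps)

lemma cinner_diff_left: "cinner (x - y) z = cinner x z - cinner y z"
  using cinner_add_left[of "x - y" y z] by (simp add: algebra_simps)

lemma cinner_diff_right: "cinner x (y - z) = cinner x y - cinner x z"
  by (metis cinner_diff_left cinner_commute complex_cnj_diff)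

lemma cinner_scaleC_right: "cinner x (c *\<^sub>C y) = cnj c * cinner x y"
  by (metis cinner_scaleC_left cinner_commute complex_cnj_mult)

lemma cinner_eq_imp_eq:
  assumes "\<And>x. cinner x y = cinner x z"
  shows "y = z"
proof -
  have "cinner (y - z) (y - z) = 0"
    using assms[of "y - z"] by (simp add: cinner_diff_right)
  then show ?thesis
    by (simp add: cinner_self)
qed

lemma norm_scaleC: "norm (c *\<^sub>C x) = cmod c * norm (x :: 'a::complex_inner)"
proof -
  have "complex_of_real ((norm (c *\<^sub>C x))\<^sup>2) = cinner (c *\<^sub>C x) (c *\<^sub>C x)"
    by (simp only: cinner_self)
  also have "\<dots> = (c * cnj c) * cinner x x"
    by (simp add: cinner_scaleC_left cinner_scaleC_right)
  also have "\<dots> = complex_of_real ((cmod c * norm x)\<^sup>2)"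
    by (simp add: cinner_self complex_norm_square[symmetric] power_mult_distrib)
  finally have "(norm (c *\<^sub>C x))\<^sup>2 = (cmod c * norm x)\<^sup>2"
    by (simp only: of_real_eq_iff)
  then show ?thesis
    by (simp add: power2_eq_iff_nonneg)
qed

text \<open>
  Rotating the first argument by a unimodular scalar makes the form real and nonnegative, so the
  real Cauchy--Schwarz inequality applies.
\<close>

lemma norm_cinner_le: "cmod (cinner x y) \<le> norm x * norm y"
proof (cases "cinner x y = 0")
  case False
  define u where "u = cnj (sgn (cinner x y))"
  have "u * cinner x y = complex_of_real (cmod (cinner x y))"
    using False
    by (simp add: u_def sgn_eq mult.commute complex_norm_square[symmetric] power2_eq_square)
  then have "cmod (cinner x y) = Re (cinner (u *\<^sub>C x) y)"
    by (simp add: cinner_scaleC_left)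
  also have "\<dots> \<le> norm (u *\<^sub>C x) * norm y"
    by (simp add: Re_cinner norm_cauchy_schwarz)
  also have "norm (u *\<^sub>C x) = norm x"
    using False by (simp add: norm_scaleC u_def norm_sgn)
  finally show ?thesis .
qed simp

lemma bounded_linear_cinner_left: "bounded_linear (\<lambda>x. cinner x y)"
proof (rule bounded_linear_intro)
  show "cinner (r *\<^sub>R x) y = r *\<^sub>R cinner x y" for r x
    by (simp add: scaleC_of_real[of r x, symmetric] cinner_scaleC_left scaleR_conv_of_real)
  show "cmod (cinner x y) \<le> norm x * norm y" for x
    by (rule norm_cinner_le)
qed (rule cinner_add_left)

lemma bounded_clinear_add: "bounded_clinear T \<Longrightarrow> T (x + y) = T x + T y"
  by (simp add: bounded_clinear_def Vector_Spaces.linear_iff)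

lemma bounded_clinear_scaleC: "bounded_clinear T \<Longrightarrow> T (c *\<^sub>C x) = c *\<^sub>C T x"
  by (simp add: bounded_clinear_def Vector_Spaces.linear_iff)

lemma bounded_clinear_bound: "bounded_clinear T \<Longrightarrow> \<exists>K\<ge>0. \<forall>x. norm (T x) \<le> K * norm x"
  unfolding bounded_clinear_def
  by (metis abs_ge_self abs_ge_zero mult_right_mono norm_ge_zero order_trans)

lemma bounded_clinearI:
  assumes "\<And>x y. T (x + y) = T x + T y" and "\<And>c x. T (c *\<^sub>C x) = c *\<^sub>C T x"
    and "\<And>x. norm (T x) \<le> K * norm x"
  shows "bounded_clinear T"
  using assms by (auto simp: bounded_clinear_def Vector_Spaces.linear_iff vector_space_scaleC)

lemma bounded_clinear_diff: "bounded_clinear T \<Longrightarrow> T (x - y) = T x - T y"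
  using bounded_clinear_add[of T "x - y" y] by (simp add: algebra_simps)

lemma bounded_linear_of_bounded_clinear:
  assumes "bounded_clinear T"
  shows "bounded_linear T"
proof -
  obtain K where "\<forall>x. norm (T x) \<le> K * norm x"
    using bounded_clinear_bound[OF assms] by blast
  then show ?thesis
    by (intro bounded_linear_intro[of _ K])
      (auto simp: bounded_clinear_add[OF assms] mult.commute scaleC_of_real[symmetric]
        bounded_clinear_scaleC[OF assms])
qed

lemma module_scaleC: "module (scaleC :: complex \<Rightarrow> 'a \<Rightarrow> 'a::complex_inner)"
  using vector_space_scaleC module_iff_vector_space by blast

lemma csubspaceD:
  assumes "csubspace W"
  shows "0 \<in> W" and "x \<in> W \<Longrightarrow> y \<in> W \<Longrightarrow> x + y \<in> W" and "x \<in> W \<Longrightarrow> c *\<^sub>C x \<in> W"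
  using assms by (auto simp: csubspace_def module.subspace_def[OF module_scaleC])

lemma subspace_of_csubspace: "csubspace W \<Longrightarrow> subspace W"
  by (auto simp: subspace_def csubspaceD scaleC_of_real[symmetric])


section \<open>Representation of functionals, adjoints and orthogonal projections\<close>

text \<open>
  This is the variational principle behind the Riesz representation theorem. The functional
  \<open>v \<mapsto> B v v - 2 l v\<close> is bounded below on \<open>W\<close>. By the parallelogram identity for \<open>B\<close> and
  coercivity, its minimising sequences are Cauchy, and the vanishing of the first variation at the
  minimiser is the asserted equation. A general form \<open>B\<close>, rather than the inner product, is what
  makes the principle applicable to least squares problems.
\<close>

lemma coercive_form_representation:
  fixes B :: "'a::{real_normed_vector,complete_space} \<Rightarrow> 'a \<Rightarrow> real"
  assumes B: "bounded_bilinear B" and sym: "\<And>u v. B u v = B v u"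
    and W: "subspace W" "closed W"
    and c: "0 < c" and coercive: "\<And>v. v \<in> W \<Longrightarrow> c * (norm v)\<^sup>2 \<le> B v v"
    and l: "bounded_linear l"
  shows "\<exists>!p. p \<in> W \<and> (\<forall>v\<in>W. B v p = l v)"
proof -
  interpret B: bounded_bilinear B by (rule B)
  interpret l: bounded_linear l by (rule l)
  define J where "J v = B v v - 2 * l v" for v
  obtain K where K: "\<And>v. \<bar>l v\<bar> \<le> norm v * K"
    using l.bounded by auto
  have J_lower: "- K\<^sup>2 / c \<le> J v" if "v \<in> W" for v
  proof -
    have "0 \<le> (c * norm v - K)\<^sup>2 / c"
      using c by simp
    also have "\<dots> = c * (norm v)\<^sup>2 - 2 * (norm v * K) + K\<^sup>2 / c"
      using c by (simp add: field_simps power2_eq_square)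
    also have "\<dots> \<le> J v + K\<^sup>2 / c"
      using coercive[OF that] K[of v] by (simp add: J_def)
    finally show ?thesis by simp
  qed
  define m where "m = Inf (J ` W)"
  have bdd: "bdd_below (J ` W)"
    using J_lower by (auto intro!: bdd_belowI2)
  have m_le: "m \<le> J v" if "v \<in> W" for v
    unfolding m_def using that bdd by (auto intro: cInf_lower)
  have "0 \<in> W" using W(1) by (rule subspace_0)
  have "\<exists>v\<in>W. J v < m + 1 / real (Suc n)" for n
  proof -
    have "\<exists>y\<in>J ` W. y < m + 1 / real (Suc n)"
      by (rule cInf_lessD) (use \<open>0 \<in> W\<close> in \<open>auto simp: m_def\<close>)
    then show ?thesis by auto
  qed
  then obtain X where XW: "\<And>n. X n \<in> W" and XJ: "\<And>n. J (X n) < m + 1 / real (Suc n)"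
    by metis
  have close: "c * (norm (u - v))\<^sup>2 \<le> 2 * (J u - m) + 2 * (J v - m)" if "u \<in> W" "v \<in> W" for u v
  proof -
    have "c * (norm (u - v))\<^sup>2 \<le> B (u - v) (u - v)"
      using that W(1) by (intro coercive) (simp add: subspace_diff)
    also have "\<dots> = 2 * J u + 2 * J v - 4 * J ((1/2) *\<^sub>R (u + v))"
      by (simp add: J_def B.add_left B.add_right B.diff_left B.diff_right B.scaleR_left
          B.scaleR_right l.add l.scaleR sym[of v u] field_simps)
    also have "\<dots> \<le> 2 * J u + 2 * J v - 4 * m"
      using m_le[of "(1/2) *\<^sub>R (u + v)"] that W(1) by (simp add: subspace_add subspace_mul)
    finally show ?thesis by simp
  qed
  have "Cauchy X"
  proof (rule metric_CauchyI)
    fix e :: real assume "0 < e"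
    then obtain N where N0: "inverse (real (Suc N)) < c * e\<^sup>2 / 4"
      using reals_Archimedean[of "c * e\<^sup>2 / 4"] c by auto
    define \<delta> where "\<delta> = inverse (real (Suc N))"
    have N: "\<delta> < c * e\<^sup>2 / 4"
      using N0 by (simp only: \<delta>_def)
    have "dist (X i) (X k) < e" if "N \<le> i" "N \<le> k" for i k
    proof -
      have *: "J (X n) - m \<le> \<delta>" if "N \<le> n" for n
      proof -
        have "J (X n) - m \<le> inverse (real (Suc n))"
          using XJ[of n] by (simp add: inverse_eq_divide)
        also have "\<dots> \<le> \<delta>"
          unfolding \<delta>_def using that by (intro le_imp_inverse_le) auto
        finally show ?thesis .
      qed
      have "c * (norm (X i - X k))\<^sup>2 \<le> 2 * (J (X i) - m) + 2 * (J (X k) - m)"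
        by (rule close[OF XW XW])
      also have "\<dots> \<le> 2 * \<delta> + 2 * \<delta>"
        by (intro add_mono mult_left_mono * that) auto
      also have "\<dots> < c * e\<^sup>2"
        using N by simp
      finally have "c * (norm (X i - X k))\<^sup>2 < c * e\<^sup>2" .
      then have "norm (X i - X k) < e"
        using c \<open>0 < e\<close> by (intro power2_less_imp_less[of _ e]) auto
      then show ?thesis by (simp add: dist_norm)
    qed
    then show "\<exists>N. \<forall>i\<ge>N. \<forall>k\<ge>N. dist (X i) (X k) < e" by blast
  qed
  then obtain p where p: "X \<longlonglongrightarrow> p"
    by (auto simp: Cauchy_convergent_iff convergent_def)
  have pW: "p \<in> W"
    using W(2) XW p by (rule closed_sequentially)
  have "J p \<le> m"
  proof (rule LIMSEQ_le)
    show "(\<lambda>n. J (X n)) \<longlonglongrightarrow> J p"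
      unfolding J_def by (intro tendsto_intros B.tendsto l.tendsto p)
    show "(\<lambda>n. m + 1 / real (Suc n)) \<longlonglongrightarrow> m"
      using tendsto_add[OF tendsto_const[of m] LIMSEQ_Suc[OF lim_1_over_n]] by simp
    show "\<exists>N. \<forall>n\<ge>N. J (X n) \<le> m + 1 / real (Suc n)"
      using XJ less_imp_le by blast
  qed
  have rep: "B v p = l v" if v: "v \<in> W" for v
  proof (rule ccontr)
    assume ne: "B v p \<noteq> l v"
    define d where "d = B v p - l v"
    define b where "b = B v v"
    have b: "0 \<le> b"
      using coercive[OF v] c by (smt (verit) b_def mult_nonneg_nonneg zero_le_power2)
    \<comment> \<open>A step of this length against the gradient lowers the value, as \<open>b < 2 (b + 1)\<close>.\<close>
    define s where "s = - d / (b + 1)"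
    have "J p \<le> J (p + s *\<^sub>R v)"
      using \<open>J p \<le> m\<close> m_le[of "p + s *\<^sub>R v"] pW v W(1) by (simp add: subspace_add subspace_mul)
    also have "\<dots> = J p + (s\<^sup>2 * b + 2 * s * d)"
      by (simp add: J_def b_def d_def B.add_left B.add_right B.scaleR_left B.scaleR_right
          l.add l.scaleR sym[of p v] algebra_simps power2_eq_square)
    also have "s\<^sup>2 * b + 2 * s * d = - (s\<^sup>2 * (b + 2))"
    proof -
      have d: "d = - s * (b + 1)"
        using b by (simp add: s_def)
      show ?thesis
        by (subst d) (simp add: power2_eq_square algebra_simps)
    qed
    finally have "s\<^sup>2 * (b + 2) \<le> 0" by simp
    moreover have "s \<noteq> 0"
      using ne b by (simp add: s_def d_def)
    then have "0 < s\<^sup>2 * (b + 2)"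
      using b by (intro mult_pos_pos) auto
    ultimately show False by simp
  qed
  show ?thesis
  proof (rule ex1I[of _ p])
    show "p \<in> W \<and> (\<forall>v\<in>W. B v p = l v)"
      using pW rep by blast
  next
    fix q assume q: "q \<in> W \<and> (\<forall>v\<in>W. B v q = l v)"
    have qp: "q - p \<in> W"
      using q pW W(1) by (simp add: subspace_diff)
    have "B (q - p) (q - p) = l (q - p) - l (q - p)"
      unfolding B.diff_right[of _ q p] using q rep[OF qp] qp by simp
    then have "c * (norm (q - p))\<^sup>2 \<le> 0"
      using coercive[OF qp] by simp
    then show "q = p"
      using c by (simp add: mult_le_0_iff)
  qed
qed

lemma complex_riesz_on_subspace:
  fixes W :: "'h::chilbert_space set" and f :: "'h \<Rightarrow> complex"
  assumes W: "csubspace W" "closed W"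
    and f: "bounded_linear f" and f_scaleC: "\<And>c x. f (c *\<^sub>C x) = c * f x"
  shows "\<exists>!p. p \<in> W \<and> (\<forall>v\<in>W. cinner v p = f v)"
proof -
  have "(\<forall>v\<in>W. cinner v p = f v) \<longleftrightarrow> (\<forall>v\<in>W. inner v p = Re (f v))" for p
  proof
    assume re: "\<forall>v\<in>W. inner v p = Re (f v)"
    show "\<forall>v\<in>W. cinner v p = f v"
    proof
      fix v assume "v \<in> W"
      \<comment> \<open>Imaginary parts are real parts at the vector rotated by \<open>-\<i>\<close>.\<close>
      then have "Re (cinner ((-\<i>) *\<^sub>C v) p) = Re (f ((-\<i>) *\<^sub>C v))"
        using re csubspaceD(3)[OF W(1)] by (simp add: Re_cinner)
      then show "cinner v p = f v"
        using re \<open>v \<in> W\<close>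
        by (simp add: complex_eq_iff Re_cinner cinner_scaleC_left f_scaleC)
    qed
  qed (metis Re_cinner)
  moreover have "\<exists>!p. p \<in> W \<and> (\<forall>v\<in>W. inner v p = Re (f v))"
  proof (rule coercive_form_representation[where c = 1])
    show "bounded_linear (\<lambda>v. Re (f v))"
      by (rule bounded_linear_compose[OF bounded_linear_Re f])
    show "subspace W"
      by (rule subspace_of_csubspace[OF W(1)])
    show "inner u v = inner v u" for u v :: 'h
      by (rule inner_commute)
  qed (simp_all add: bounded_bilinear_inner W power2_norm_eq_inner)
  ultimately show ?thesis by simp
qed

lemma orth_proj:
  fixes W :: "'h::chilbert_space set"
  assumes W: "csubspace W" "closed W"
  shows "orth_proj W x \<in> W" and "v \<in> W \<Longrightarrow> cinner v (orth_proj W x) = cinner v x"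
proof -
  have "cinner (x - p) v = 0 \<longleftrightarrow> cinner v p = cinner v x" for p v
    by (metis cinner_commute cinner_diff_right complex_cnj_zero_iff eq_iff_diff_eq_0)
  then have eq: "orth_proj W x = (THE p. p \<in> W \<and> (\<forall>v\<in>W. cinner v p = cinner v x))"
    by (simp add: orth_proj_def)
  have "\<exists>!p. p \<in> W \<and> (\<forall>v\<in>W. cinner v p = cinner v x)"
    by (rule complex_riesz_on_subspace[OF W bounded_linear_cinner_left cinner_scaleC_left])
  from theI'[OF this]
  show "orth_proj W x \<in> W" and "v \<in> W \<Longrightarrow> cinner v (orth_proj W x) = cinner v x"
    by (auto simp: eq)
qed

lemma ex1_cadjoint:
  fixes A :: "'h::chilbert_space \<Rightarrow> 'h"
  assumes A: "bounded_clinear A"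
  shows "\<exists>!B. \<forall>x y. cinner (A x) y = cinner x (B y)"
proof -
  have "\<exists>!p. p \<in> UNIV \<and> (\<forall>v\<in>UNIV. cinner v p = cinner (A v) y)" for y
  proof (rule complex_riesz_on_subspace)
    show "csubspace (UNIV :: 'h set)"
      unfolding csubspace_def
      by (simp add: module.subspace_UNIV module_scaleC)
    show "bounded_linear (\<lambda>v. cinner (A v) y)"
      by (intro bounded_linear_compose[OF bounded_linear_cinner_left]
          bounded_linear_of_bounded_clinear A)
  qed (auto simp: bounded_clinear_scaleC[OF A] cinner_scaleC_left)
  then have "\<exists>p. \<forall>v. cinner v p = cinner (A v) y" for y
    by blast
  then obtain B where B: "\<And>y v. cinner v (B y) = cinner (A v) y"
    by metis
  show ?thesis
  proof (rule ex1I[of _ B])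
    fix C assume C: "\<forall>x y. cinner (A x) y = cinner x (C y)"
    show "C = B"
    proof
      show "C y = B y" for y
        by (rule cinner_eq_imp_eq) (simp add: B C[rule_format, symmetric])
    qed
  qed (simp add: B)
qed

lemma cinner_cadjoint:
  fixes A :: "'h::chilbert_space \<Rightarrow> 'h"
  assumes "bounded_clinear A"
  shows "cinner x (cadjoint A y) = cinner (A x) y"
  using theI'[OF ex1_cadjoint[OF assms], folded cadjoint_def] by simp

text \<open>
  Surjectivity of \<open>I - A\<^sup>*\<close> already determines how its inverse acts in inner products. A
  preimage of \<open>g\<close> is \<open>F\<^sup>* g\<close>, where \<open>F = (I - A)\<^sup>-\<^sup>1\<close>.
\<close>

lemma cinner_inv_id_minus_cadjoint:
  fixes A F :: "'h::chilbert_space \<Rightarrow> 'h"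
  assumes A: "bounded_clinear A" and F: "bounded_clinear F"
    and left: "\<And>x. F (x - A x) = x" and right: "\<And>x. F x - A (F x) = x"
  shows "cinner w (inv (\<lambda>x. x - cadjoint A x) g) = cinner (F w) g"
proof -
  define y where "y = inv (\<lambda>x. x - cadjoint A x) g"
  have "cadjoint F g - cadjoint A (cadjoint F g) = g"
  proof (rule cinner_eq_imp_eq)
    fix x
    have "cinner x (cadjoint F g - cadjoint A (cadjoint F g)) = cinner (F x - F (A x)) g"
      by (simp add: cinner_diff_right cinner_diff_left cinner_cadjoint A F)
    also have "F x - F (A x) = x"
      using left[of x] by (simp add: bounded_clinear_diff[OF F])
    finally show "cinner x (cadjoint F g - cadjoint A (cadjoint F g)) = cinner x g" .
  qed
  then have "g \<in> range (\<lambda>x. x - cadjoint A x)"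
    by (intro range_eqI[of _ _ "cadjoint F g"]) simp
  then have y: "y - cadjoint A y = g"
    unfolding y_def by (rule f_inv_into_f)
  have "cinner (F w) g = cinner (F w - A (F w)) y"
    by (simp add: y[symmetric] cinner_diff_right cinner_diff_left cinner_cadjoint A)
  then show ?thesis
    by (simp add: right y_def)
qed


section \<open>Decay of powers below spectral radius one\<close>

text \<open>
  Outside the disc of radius \<open>K\<close> the equation \<open>c x - A x = y\<close> is a fixed point problem for a
  contraction.
\<close>

lemma cmod_le_of_cspectrum:
  fixes A :: "'h::chilbert_space \<Rightarrow> 'h"
  assumes A: "bounded_clinear A" and K: "0 \<le> K" "\<And>x. norm (A x) \<le> K * norm x"
    and spec: "c \<in> cspectrum A"
  shows "cmod c \<le> K"
proof (rule ccontr)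
  assume "\<not> cmod c \<le> K"
  then have c: "K < cmod c" "c \<noteq> 0"
    using K(1) by auto
  have "\<exists>x. c *\<^sub>C x - A x = y" for y
  proof -
    have "dist ((1 / c) *\<^sub>C (A u + y)) ((1 / c) *\<^sub>C (A v + y)) \<le> K / cmod c * dist u v" for u v
    proof -
      have "dist ((1 / c) *\<^sub>C (A u + y)) ((1 / c) *\<^sub>C (A v + y)) = norm (A (u - v)) / cmod c"
        by (simp add: dist_norm scaleC_diff_right[symmetric] norm_scaleC norm_divide
            bounded_clinear_diff[OF A])
      also have "\<dots> \<le> K * norm (u - v) / cmod c"
        using K(2) by (intro divide_right_mono) auto
      finally show ?thesis by (simp add: dist_norm)
    qed
    then have "\<exists>!x. (1 / c) *\<^sub>C (A x + y) = x"
      using K(1) c by (intro banach_fix_type[of "K / cmod c"]) auto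
    then obtain x where x: "(1 / c) *\<^sub>C (A x + y) = x" by blast
    have "c *\<^sub>C x = A x + y"
      using c(2) by (subst x[symmetric]) (simp add: scaleC_scaleC)
    then show ?thesis by (intro exI[of _ x]) simp
  qed
  then obtain B where B: "\<And>y. c *\<^sub>C B y - A (B y) = y" by metis
  have below: "(cmod c - K) * norm x \<le> norm (c *\<^sub>C x - A x)" for x
  proof -
    have "cmod c * norm x = norm (c *\<^sub>C x)" by (simp add: norm_scaleC)
    also have "\<dots> \<le> norm (c *\<^sub>C x - A x) + norm (A x)"
      by (metis diff_add_cancel norm_triangle_ineq)
    also have "\<dots> \<le> norm (c *\<^sub>C x - A x) + K * norm x"
      using K(2) by simp
    finally show ?thesis by (simp add: left_diff_distrib)
  qed
  have inj: "x = y" if "c *\<^sub>C x - A x = c *\<^sub>C y - A y" for x y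
  proof -
    have "c *\<^sub>C (x - y) - A (x - y) = 0"
      using that by (simp add: scaleC_diff_right bounded_clinear_diff[OF A] algebra_simps)
    then have "(cmod c - K) * norm (x - y) \<le> 0"
      using below[of "x - y"] by simp
    then show ?thesis
      using c(1) by (simp add: mult_le_0_iff)
  qed
  have "bounded_clinear B"
  proof (rule bounded_clinearI)
    show "B (x + y) = B x + B y" for x y
    proof (rule inj)
      have "c *\<^sub>C (B x + B y) - A (B x + B y) = (c *\<^sub>C B x - A (B x)) + (c *\<^sub>C B y - A (B y))"
        by (simp add: scaleC_add_right bounded_clinear_add[OF A])
      then show "c *\<^sub>C B (x + y) - A (B (x + y)) = c *\<^sub>C (B x + B y) - A (B x + B y)"
        by (simp add: B)
    qed
    show "B (d *\<^sub>C x) = d *\<^sub>C B x" for d x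
    proof (rule inj)
      have "c *\<^sub>C (d *\<^sub>C B x) - A (d *\<^sub>C B x) = d *\<^sub>C (c *\<^sub>C B x - A (B x))"
        by (simp add: scaleC_diff_right scaleC_scaleC bounded_clinear_scaleC[OF A] mult.commute)
      then show "c *\<^sub>C B (d *\<^sub>C x) - A (B (d *\<^sub>C x)) = c *\<^sub>C (d *\<^sub>C B x) - A (d *\<^sub>C B x)"
        by (simp add: B)
    qed
    show "norm (B x) \<le> 1 / (cmod c - K) * norm x" for x
      using below[of "B x"] c(1) by (simp add: B field_simps)
  qed
  moreover have "B (c *\<^sub>C x - A x) = x" for x
    by (rule inj) (rule B)
  ultimately show False
    using spec B by (auto simp: cspectrum_def)
qed

lemma cmod_le_spectral_radius:
  fixes A :: "'h::chilbert_space \<Rightarrow> 'h"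
  assumes A: "bounded_clinear A" and "c \<in> cspectrum A"
  shows "cmod c \<le> spectral_radius A"
proof -
  obtain K where "0 \<le> K" "\<And>x. norm (A x) \<le> K * norm x"
    using bounded_clinear_bound[OF A] by blast
  then have "bdd_above (insert 0 (norm ` cspectrum A))"
    by (auto intro!: bdd_aboveI2 cmod_le_of_cspectrum[OF A])
  then show ?thesis
    unfolding spectral_radius_def using assms(2) by (intro cSup_upper) auto
qed

lemma resolvent_identity:
  fixes A :: "'h::chilbert_space \<Rightarrow> 'h"
  assumes F: "bounded_clinear F" and left: "\<And>x. F (x - w *\<^sub>C A x) = x"
    and u: "u - z *\<^sub>C A u = x"
  shows "u - F x = (z - w) *\<^sub>C F (A u)"
proof -
  have "F x = F ((u - w *\<^sub>C A u) - (z - w) *\<^sub>C A u)"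
    by (simp add: u[symmetric] scaleC_diff_left)
  also have "\<dots> = u - (z - w) *\<^sub>C F (A u)"
    by (subst bounded_clinear_diff[OF F]) (simp only: left bounded_clinear_scaleC[OF F])
  finally show ?thesis by simp
qed

text \<open>
  The family \<open>z \<mapsto> (I - z A)\<^sup>-\<^sup>1\<close> in place of the resolvent \<open>(c - A)\<^sup>-\<^sup>1\<close> moves the point at infinity
  to \<open>0\<close>, so that the powers of \<open>A\<close> appear as Taylor coefficients.
\<close>

locale neumann_family =
  fixes A :: "'h::chilbert_space \<Rightarrow> 'h" and F :: "complex \<Rightarrow> 'h \<Rightarrow> 'h" and R :: real
  assumes A: "bounded_clinear A"
    and F: "cmod z < R \<Longrightarrow> bounded_clinear (F z)"
    and left: "cmod z < R \<Longrightarrow> F z (x - z *\<^sub>C A x) = x"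
    and right: "cmod z < R \<Longrightarrow> F z x - z *\<^sub>C A (F z x) = x"
begin

lemma difference:
  "cmod z < R \<Longrightarrow> cmod w < R \<Longrightarrow> F z x - F w x = (z - w) *\<^sub>C F w (A (F z x))"
  by (rule resolvent_identity) (auto simp: F left right)

text \<open>
  The difference formula first bounds \<open>\<parallel>F z x\<parallel>\<close> by \<open>2 \<parallel>F w x\<parallel>\<close> for \<open>z\<close> near \<open>w\<close>, and with this
  bound it yields continuity.
\<close>

lemma continuous: "continuous_on (ball 0 R) (\<lambda>z. F z x)"
  unfolding continuous_on_def
proof
  fix w :: complex assume "w \<in> ball 0 R"
  then have w: "cmod w < R" by simp
  obtain KF where KF: "0 \<le> KF" "\<And>y. norm (F w y) \<le> KF * norm y"
    using bounded_clinear_bound[OF F[OF w]] by blast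
  obtain KA where KA: "0 \<le> KA" "\<And>y. norm (A y) \<le> KA * norm y"
    using bounded_clinear_bound[OF A] by blast
  define K where "K = KF * KA"
  have K: "norm (F w (A y)) \<le> K * norm y" for y
    using KF(2)[of "A y"] mult_left_mono[OF KA(2)[of y] KF(1)] by (simp add: K_def mult.assoc)
  have diff: "norm (F z x - F w x) \<le> cmod (z - w) * K * norm (F z x)" if "cmod z < R" for z
    using mult_left_mono[OF K[of "F z x"], of "cmod (z - w)"]
    by (simp add: difference[OF that w] norm_scaleC mult.assoc)
  have lim0: "((\<lambda>z. cmod (z - w) * C) \<longlongrightarrow> 0) (at w within ball 0 R)" for C
    by (rule tendsto_eq_intros refl | simp)+
  have "\<forall>\<^sub>F z in at w within ball 0 R. cmod (z - w) * K < 1 / 2"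
    by (rule order_tendstoD(2)[OF lim0]) simp
  moreover have "\<forall>\<^sub>F z in at w within ball 0 R. z \<in> ball 0 R"
    by (simp add: eventually_at_topological) blast
  ultimately have "\<forall>\<^sub>F z in at w within ball 0 R.
      norm (F z x - F w x) \<le> cmod (z - w) * (K * (2 * norm (F w x)))"
  proof eventually_elim
    fix z assume z: "cmod (z - w) * K < 1 / 2" "z \<in> ball 0 R"
    then have d: "norm (F z x - F w x) \<le> cmod (z - w) * K * norm (F z x)"
      using diff by simp
    also have "\<dots> \<le> 1 / 2 * norm (F z x)"
      using z by (intro mult_right_mono) auto
    finally have "norm (F z x) \<le> 2 * norm (F w x)"
      using norm_triangle_ineq2[of "F z x" "F w x"] by simp
    then have "cmod (z - w) * K * norm (F z x) \<le> cmod (z - w) * K * (2 * norm (F w x))"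
      using KF(1) KA(1) by (intro mult_left_mono) (auto simp: K_def)
    with d show "norm (F z x - F w x) \<le> cmod (z - w) * (K * (2 * norm (F w x)))"
      by (simp add: mult.assoc)
  qed
  then have "((\<lambda>z. F z x - F w x) \<longlongrightarrow> 0) (at w within ball 0 R)"
    by (rule Lim_null_comparison) (rule lim0)
  then show "((\<lambda>z. F z x) \<longlongrightarrow> F w x) (at w within ball 0 R)"
    by (rule LIM_zero_cancel)
qed

lemma holomorphic: "(\<lambda>z. cinner (F z x) y) holomorphic_on ball 0 R"
  unfolding holomorphic_on_def field_differentiable_def
proof
  fix w :: complex assume wR: "w \<in> ball 0 R"
  then have w: "cmod w < R" by simp
  have "((\<lambda>z. F z x) \<longlongrightarrow> F w x) (at w within ball 0 R)"
    using continuous wR by (simp add: continuous_on_def)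
  moreover have "bounded_linear (\<lambda>v. cinner (F w (A v)) y)"
    by (intro bounded_linear_compose[OF bounded_linear_cinner_left]
        bounded_linear_compose[OF bounded_linear_of_bounded_clinear[OF F[OF w]]]
        bounded_linear_of_bounded_clinear A)
  ultimately have "((\<lambda>z. cinner (F w (A (F z x))) y) \<longlongrightarrow> cinner (F w (A (F w x))) y)
      (at w within ball 0 R)"
    by (rule bounded_linear.tendsto[rotated])
  moreover have "\<forall>\<^sub>F z in at w within ball 0 R. cinner (F w (A (F z x))) y
      = (cinner (F z x) y - cinner (F w x) y) / (z - w)"
    unfolding eventually_at_topological
  proof (intro exI[of _ UNIV] conjI ballI impI)
    fix z assume "z \<noteq> w" "z \<in> ball 0 R"
    then show "cinner (F w (A (F z x))) y = (cinner (F z x) y - cinner (F w x) y) / (z - w)"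
      using difference[of z w x] w by (simp add: cinner_diff_left[symmetric] cinner_scaleC_left)
  qed auto
  ultimately have "((\<lambda>z. (cinner (F z x) y - cinner (F w x) y) / (z - w))
      \<longlongrightarrow> cinner (F w (A (F w x))) y) (at w within ball 0 R)"
    by (rule Lim_transform_eventually)
  then show "\<exists>d. ((\<lambda>z. cinner (F z x) y) has_field_derivative d) (at w within ball 0 R)"
    by (auto simp: has_field_derivative_iff)
qed

lemma at_zero: "0 < R \<Longrightarrow> F 0 x = x"
  using left[of 0 x] by simp

text \<open>
  The relation \<open>F z v = v + z F z (A v)\<close> shifts Taylor coefficients: the expansion for \<open>v\<close> is
  its constant term plus \<open>z\<close> times the expansion for \<open>A v\<close>.
\<close>

lemma higher_deriv_at_zero:
  assumes R: "0 < R"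
  shows "(deriv ^^ k) (\<lambda>z. cinner (F z v) y) 0 = fact k * cinner ((A ^^ k) v) y"
proof (induction k arbitrary: v)
  case 0
  then show ?case by (simp add: at_zero R)
next
  case (Suc k)
  let ?\<phi> = "\<lambda>v z. cinner (F z v) y"
  have expansion: "?\<phi> u has_fps_expansion fps_expansion (?\<phi> u) 0" for u
    using holomorphic[of u y] R by (intro has_fps_expansion_fps_expansion[of "ball 0 R"]) auto
  let ?G = "fps_const (cinner v y) + fps_X * fps_expansion (?\<phi> (A v)) 0"
  have G: "(\<lambda>z. cinner v y + z * ?\<phi> (A v) z) has_fps_expansion ?G"
    by (intro fps_expansion_intros expansion)
  have "\<forall>\<^sub>F z in nhds 0. z \<in> ball 0 R"
    using R by (intro eventually_nhds_in_open) auto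
  then have "\<forall>\<^sub>F z in nhds 0. cinner v y + z * ?\<phi> (A v) z = ?\<phi> v z"
  proof eventually_elim
    fix z :: complex assume "z \<in> ball 0 R"
    then have z: "cmod z < R" by simp
    have "F z v - z *\<^sub>C F z (A v) = v"
      using left[OF z, of v]
      by (simp add: bounded_clinear_diff[OF F[OF z]] bounded_clinear_scaleC[OF F[OF z]])
    then have "cinner v y = cinner (F z v) y - z * cinner (F z (A v)) y"
      by (metis cinner_diff_left cinner_scaleC_left)
    then show "cinner v y + z * ?\<phi> (A v) z = ?\<phi> v z"
      by simp
  qed
  with G have "?\<phi> v has_fps_expansion ?G"
    unfolding has_fps_expansion_def by (auto elim: eventually_elim2)
  then have "(deriv ^^ Suc k) (?\<phi> v) 0 / fact (Suc k) = fps_nth ?G (Suc k)"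
    by (rule fps_nth_fps_expansion[symmetric])
  also have "\<dots> = fps_nth (fps_expansion (?\<phi> (A v)) 0) k"
    by simp
  also have "\<dots> = cinner ((A ^^ Suc k) v) y"
    by (simp add: fps_nth_fps_expansion[OF expansion] Suc.IH funpow_Suc_right del: funpow.simps)
  finally show ?case
    by (simp only: nonzero_divide_eq_eq[OF fact_nonzero] mult.commute)
qed

text \<open>
  Cauchy's inequality bounds the coefficient \<open>\<langle>A\<^sup>n x, y\<rangle>\<close> by \<open>\<parallel>y\<parallel>\<close> times a factor that does not
  depend on \<open>y\<close>. The choice \<open>y = A\<^sup>n x\<close> turns this weak bound into a norm bound.
\<close>

lemma power_bound:
  assumes r: "0 < r" "r < R"
  shows "\<exists>M. \<forall>n. norm ((A ^^ n) x) \<le> M / r ^ n"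
proof -
  have sub: "cball 0 r \<subseteq> ball 0 R"
    using r by auto
  then have "compact ((\<lambda>z. F z x) ` cball 0 r)"
    by (intro compact_continuous_image continuous_on_subset[OF continuous]) auto
  then obtain M where M: "\<And>z. z \<in> cball 0 r \<Longrightarrow> norm (F z x) \<le> M"
    using compact_imp_bounded bounded_iff by (metis image_eqI)
  have "0 \<le> M"
    using M[of 0] r by (smt (verit) centre_in_cball norm_ge_zero)
  have "norm ((A ^^ n) x) \<le> M / r ^ n" for n
  proof -
    let ?y = "(A ^^ n) x"
    have "norm ((deriv ^^ n) (\<lambda>z. cinner (F z x) ?y) 0) \<le> fact n * (M * norm ?y) / r ^ n"
    proof (rule Cauchy_inequality)
      show "(\<lambda>z. cinner (F z x) ?y) holomorphic_on ball 0 r"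
        using sub by (intro holomorphic_on_subset[OF holomorphic]) auto
      show "continuous_on (cball 0 r) (\<lambda>z. cinner (F z x) ?y)"
        using sub by (intro holomorphic_on_imp_continuous_on holomorphic_on_subset[OF holomorphic])
      fix z :: complex assume "norm (0 - z) = r"
      then have "norm (F z x) * norm ?y \<le> M * norm ?y"
        using M[of z] by (intro mult_right_mono) auto
      then show "norm (cinner (F z x) ?y) \<le> M * norm ?y"
        using norm_cinner_le[of "F z x" ?y] by simp
    qed (use r in auto)
    then have "fact n * (norm ?y)\<^sup>2 \<le> fact n * (M * norm ?y / r ^ n)"
      using r by (simp add: higher_deriv_at_zero norm_mult cinner_self norm_power)
    then have "(norm ?y)\<^sup>2 \<le> M * norm ?y / r ^ n"
      by (simp only: mult_le_cancel_left_pos[OF fact_gt_zero])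
    then have "norm ?y * norm ?y \<le> norm ?y * (M / r ^ n)"
      by (simp add: power2_eq_square mult.commute)
    then show ?thesis
      using \<open>0 \<le> M\<close> r mult_left_le_imp_le[of "norm ?y" "norm ?y" "M / r ^ n"]
      by (cases "?y = 0") auto
  qed
  then show ?thesis by blast
qed

end

theorem powers_tendsto_zero:
  fixes A :: "'h::chilbert_space \<Rightarrow> 'h"
  assumes A: "bounded_clinear A" and rho: "spectral_radius A < 1"
  shows "(\<lambda>n. (A ^^ n) x) \<longlonglongrightarrow> 0"
proof -
  obtain s where s: "max 0 (spectral_radius A) < s" "s < 1"
    using rho dense[of "max 0 (spectral_radius A)" 1] by auto
  then have s: "0 < s" "s < 1" "spectral_radius A < s"
    by auto
  have "\<exists>B. bounded_clinear B \<and> (\<forall>x. B (x - z *\<^sub>C A x) = x) \<and> (\<forall>x. B x - z *\<^sub>C A (B x) = x)"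
    if z: "cmod z < 1 / s" for z
  proof (cases "z = 0")
    case True
    then show ?thesis
      by (intro exI[of _ "\<lambda>x. x"]) (auto intro: bounded_clinearI[of _ 1])
  next
    case False
    then have "s < cmod (1 / z)"
      using z s(1) by (simp add: norm_divide field_simps)
    then have "1 / z \<notin> cspectrum A"
      using cmod_le_spectral_radius[OF A] s(3) by force
    then obtain C where C: "bounded_clinear C" "\<And>x. C ((1 / z) *\<^sub>C x - A x) = x"
      "\<And>x. (1 / z) *\<^sub>C C x - A (C x) = x"
      by (auto simp: cspectrum_def)
    obtain K where K: "\<And>x. norm (C x) \<le> K * norm x"
      using bounded_clinear_bound[OF C(1)] by blast
    have zC: "C x - z *\<^sub>C A (C x) = z *\<^sub>C x" for x
      using False arg_cong[OF C(3)[of x], of "\<lambda>u. z *\<^sub>C u"]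
      by (simp add: scaleC_diff_right scaleC_scaleC)
    show ?thesis
    proof (intro exI[of _ "\<lambda>x. (1 / z) *\<^sub>C C x"] conjI allI)
      show "bounded_clinear (\<lambda>x. (1 / z) *\<^sub>C C x)"
        using mult_left_mono[OF K, of "1 / cmod z"]
        by (intro bounded_clinearI[of _ "K / cmod z"])
          (auto simp: bounded_clinear_add[OF C(1)] bounded_clinear_scaleC[OF C(1)] scaleC_scaleC
            scaleC_add_right norm_scaleC norm_divide mult.commute)
      show "(1 / z) *\<^sub>C C (x - z *\<^sub>C A x) = x" for x
      proof -
        have "(1 / z) *\<^sub>C C (x - z *\<^sub>C A x) = C ((1 / z) *\<^sub>C (x - z *\<^sub>C A x))"
          by (simp only: bounded_clinear_scaleC[OF C(1)])
        also have "(1 / z) *\<^sub>C (x - z *\<^sub>C A x) = (1 / z) *\<^sub>C x - A x"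
          using False by (simp add: scaleC_diff_right scaleC_scaleC)
        finally show ?thesis by (simp only: C(2))
      qed
      show "(1 / z) *\<^sub>C C x - z *\<^sub>C A ((1 / z) *\<^sub>C C x) = x" for x
        using False C(3)[of x] by (simp add: bounded_clinear_scaleC[OF A] scaleC_scaleC)
    qed
  qed
  then obtain F where F: "\<And>z. cmod z < 1 / s \<Longrightarrow> bounded_clinear (F z)"
    "\<And>z x. cmod z < 1 / s \<Longrightarrow> F z (x - z *\<^sub>C A x) = x"
    "\<And>z x. cmod z < 1 / s \<Longrightarrow> F z x - z *\<^sub>C A (F z x) = x"
    by metis
  interpret neumann_family A F "1 / s"
    by unfold_locales (fact A F)+
  obtain r where r: "1 < r" "r < 1 / s"
    using dense[of 1 "1 / s"] s by auto
  then obtain M where M: "\<And>n. norm ((A ^^ n) x) \<le> M / r ^ n"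
    using power_bound[of r x] by auto
  have "(\<lambda>n. M / r ^ n) \<longlonglongrightarrow> 0"
    using tendsto_mult_right_zero[OF LIMSEQ_realpow_zero[of "1 / r"], of M] r
    by (simp add: power_one_over field_simps)
  then show ?thesis
    by (rule Lim_null_comparison[rotated]) (simp add: M)
qed


section \<open>Square summable sequences and least squares\<close>

lemma ell2_norm_power2:
  assumes "a \<in> ell2"
  shows "(ell2_norm a)\<^sup>2 = (\<Sum>j. (cmod (a j))\<^sup>2)"
  using assms by (simp add: ell2_norm_def ell2_def suminf_nonneg)

lemma ell2_norm_nonneg: "a \<in> ell2 \<Longrightarrow> 0 \<le> ell2_norm a"
  by (simp add: ell2_norm_def ell2_def suminf_nonneg)

lemma L2_set_le_ell2_norm:
  assumes "a \<in> ell2"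
  shows "L2_set (\<lambda>j. cmod (a j)) {..<n} \<le> ell2_norm a"
  using assms unfolding L2_set_def ell2_norm_def ell2_def
  by (intro real_sqrt_le_mono sum_le_suminf) auto

lemma cmod_le_ell2_norm:
  assumes "a \<in> ell2"
  shows "cmod (a j) \<le> ell2_norm a"
  using member_le_L2_set[of "{..<Suc j}" j "\<lambda>j. cmod (a j)"] L2_set_le_ell2_norm[OF assms, of "Suc j"]
  by simp

lemma ell2_triangle:
  assumes a: "a \<in> ell2" and b: "b \<in> ell2"
  shows "(\<lambda>j. a j + b j) \<in> ell2"
    and "ell2_norm (\<lambda>j. a j + b j) \<le> ell2_norm a + ell2_norm b"
proof -
  have bound: "(\<Sum>j<n. (cmod (a j + b j))\<^sup>2) \<le> (ell2_norm a + ell2_norm b)\<^sup>2" for n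
  proof -
    have "(\<Sum>j<n. (cmod (a j + b j))\<^sup>2) \<le> (\<Sum>j<n. (cmod (a j) + cmod (b j))\<^sup>2)"
      by (intro sum_mono power_mono norm_triangle_ineq) auto
    also have "\<dots> = (L2_set (\<lambda>j. cmod (a j) + cmod (b j)) {..<n})\<^sup>2"
      by (simp add: L2_set_def sum_nonneg)
    also have "\<dots> \<le> (ell2_norm a + ell2_norm b)\<^sup>2"
      using L2_set_triangle_ineq[of "\<lambda>j. cmod (a j)" "\<lambda>j. cmod (b j)" "{..<n}"]
        L2_set_le_ell2_norm[OF a, of n] L2_set_le_ell2_norm[OF b, of n]
      by (intro power_mono) (auto simp: L2_set_nonneg)
    finally show ?thesis .
  qed
  then have s: "summable (\<lambda>j. (cmod (a j + b j))\<^sup>2)"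
    by (intro summableI_nonneg_bounded) auto
  then show "(\<lambda>j. a j + b j) \<in> ell2"
    by (simp add: ell2_def)
  have "(\<Sum>j. (cmod (a j + b j))\<^sup>2) \<le> (ell2_norm a + ell2_norm b)\<^sup>2"
    by (rule suminf_le_const[OF s bound])
  then show "ell2_norm (\<lambda>j. a j + b j) \<le> ell2_norm a + ell2_norm b"
    using ell2_norm_nonneg[OF a] ell2_norm_nonneg[OF b]
    unfolding ell2_norm_def[of "\<lambda>j. a j + b j"] by (intro real_le_lsqrt) auto
qed

lemma ell2_cmult:
  assumes "a \<in> ell2"
  shows "(\<lambda>j. c * a j) \<in> ell2" and "ell2_norm (\<lambda>j. c * a j) = cmod c * ell2_norm a"
  using assms
  by (auto simp: ell2_def ell2_norm_def norm_mult power_mult_distrib summable_mult suminf_mult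
      real_sqrt_mult)

lemma ell2_diff:
  assumes a: "a \<in> ell2" and b: "b \<in> ell2"
  shows "(\<lambda>j. a j - b j) \<in> ell2"
  using ell2_triangle(1)[OF a ell2_cmult(1)[OF b, of "-1"]] by simp

text \<open>
  This is the real part of the inner product on \<open>\<ell>\<^sup>2\<close>. The minimisation argument is real, and
  complex linearity of its solution follows from moving scalars across the form.
\<close>

definition ell2_inner :: "(nat \<Rightarrow> complex) \<Rightarrow> (nat \<Rightarrow> complex) \<Rightarrow> real" where
  "ell2_inner a b = (\<Sum>j. inner (a j) (b j))"

lemma ell2_Cauchy_Schwarz:
  assumes a: "a \<in> ell2" and b: "b \<in> ell2"
  shows "summable (\<lambda>j. inner (a j) (b j))" and "\<bar>ell2_inner a b\<bar> \<le> ell2_norm a * ell2_norm b"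
proof -
  have bound: "(\<Sum>j<n. \<bar>inner (a j) (b j)\<bar>) \<le> ell2_norm a * ell2_norm b" for n
  proof -
    have "(\<Sum>j<n. \<bar>inner (a j) (b j)\<bar>) \<le> (\<Sum>j<n. \<bar>cmod (a j)\<bar> * \<bar>cmod (b j)\<bar>)"
      by (intro sum_mono) (simp add: Cauchy_Schwarz_ineq2)
    also have "\<dots> \<le> L2_set (\<lambda>j. cmod (a j)) {..<n} * L2_set (\<lambda>j. cmod (b j)) {..<n}"
      by (rule L2_set_mult_ineq)
    also have "\<dots> \<le> ell2_norm a * ell2_norm b"
      using a b by (intro mult_mono L2_set_le_ell2_norm ell2_norm_nonneg L2_set_nonneg)
    finally show ?thesis .
  qed
  then have s: "summable (\<lambda>j. \<bar>inner (a j) (b j)\<bar>)"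
    by (intro summableI_nonneg_bounded) auto
  then show "summable (\<lambda>j. inner (a j) (b j))"
    by (rule summable_rabs_cancel)
  have "\<bar>ell2_inner a b\<bar> \<le> (\<Sum>j. \<bar>inner (a j) (b j)\<bar>)"
    unfolding ell2_inner_def by (rule summable_rabs[OF s])
  also have "\<dots> \<le> ell2_norm a * ell2_norm b"
    by (rule suminf_le_const[OF s bound])
  finally show "\<bar>ell2_inner a b\<bar> \<le> ell2_norm a * ell2_norm b" .
qed

lemma ell2_inner_commute: "ell2_inner a b = ell2_inner b a"
  by (simp add: ell2_inner_def inner_commute)

lemma ell2_inner_self: "a \<in> ell2 \<Longrightarrow> ell2_inner a a = (ell2_norm a)\<^sup>2"
  by (simp add: ell2_norm_power2 ell2_inner_def power2_norm_eq_inner)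

lemma ell2_inner_add_left:
  assumes "a \<in> ell2" "b \<in> ell2" "d \<in> ell2"
  shows "ell2_inner (\<lambda>j. a j + b j) d = ell2_inner a d + ell2_inner b d"
  using assms by (simp add: ell2_inner_def inner_add_left suminf_add ell2_Cauchy_Schwarz(1))

lemma ell2_inner_of_real_left:
  assumes "a \<in> ell2" "b \<in> ell2"
  shows "ell2_inner (\<lambda>j. complex_of_real r * a j) b = r * ell2_inner a b"
proof -
  have "inner (complex_of_real r * x) y = r * inner x y" for x y
    by (simp add: scaleR_conv_of_real[symmetric])
  then show ?thesis
    using assms by (simp add: ell2_inner_def suminf_mult ell2_Cauchy_Schwarz(1))
qed

lemma ell2_inner_cmult_left:
  "ell2_inner (\<lambda>j. c * a j) b = ell2_inner a (\<lambda>j. cnj c * b j)"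
  by (simp add: ell2_inner_def inner_complex_def algebra_simps)

text \<open>
  The operator \<open>L\<close> sends \<open>a\<close> to the element \<open>p\<close> of \<open>W\<close> for which \<open>T p\<close> is the best approximation
  of \<open>a\<close>. The normal equations for \<open>p\<close> involve the form \<open>\<langle>T u, T v\<rangle>\<close>, which is coercive on \<open>W\<close>
  precisely because \<open>T\<close> is bounded below there.
\<close>

lemma bounded_below_imp_left_inverse:
  fixes T :: "'h::chilbert_space \<Rightarrow> nat \<Rightarrow> complex"
  assumes W: "csubspace W" "closed W"
    and T_add: "\<And>x y. T (x + y) = (\<lambda>j. T x j + T y j)"
    and T_scaleC: "\<And>c x. T (c *\<^sub>C x) = (\<lambda>j. c * T x j)"
    and T_ell2: "\<And>x. T x \<in> ell2"
    and T_bound: "\<And>x. ell2_norm (T x) \<le> K * norm x"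
    and c: "0 < c" and T_below: "\<And>w. w \<in> W \<Longrightarrow> c * norm w \<le> ell2_norm (T w)"
  shows "\<exists>L. (\<forall>a\<in>ell2. \<forall>b\<in>ell2. L (\<lambda>j. a j + b j) = L a + L b) \<and>
    (\<forall>d. \<forall>a\<in>ell2. L (\<lambda>j. d * a j) = d *\<^sub>C L a) \<and>
    (\<forall>a\<in>ell2. c * norm (L a) \<le> ell2_norm a) \<and> (\<forall>w\<in>W. L (T w) = w)"
proof -
  have T_scaleR: "T (r *\<^sub>R x) = (\<lambda>j. complex_of_real r * T x j)" for r x
    by (simp add: scaleC_of_real[of r x, symmetric] T_scaleC)
  have bil: "bounded_bilinear (\<lambda>u v. ell2_inner (T u) (T v))"
  proof
    have left: "ell2_inner (T (u + u')) (T v) = ell2_inner (T u) (T v) + ell2_inner (T u') (T v)"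
      and left_scale: "ell2_inner (T (r *\<^sub>R u)) (T v) = r *\<^sub>R ell2_inner (T u) (T v)"
      for u u' v r
      by (simp_all add: T_add T_scaleR T_ell2 ell2_inner_add_left ell2_inner_of_real_left)
    fix u u' v :: 'h and r :: real
    show "ell2_inner (T (u + u')) (T v) = ell2_inner (T u) (T v) + ell2_inner (T u') (T v)"
      by (rule left)
    show "ell2_inner (T (r *\<^sub>R u)) (T v) = r *\<^sub>R ell2_inner (T u) (T v)"
      by (rule left_scale)
    show "ell2_inner (T v) (T (u + u')) = ell2_inner (T v) (T u) + ell2_inner (T v) (T u')"
      by (simp only: ell2_inner_commute[of "T v"] left)
    show "ell2_inner (T v) (T (r *\<^sub>R u)) = r *\<^sub>R ell2_inner (T v) (T u)"
      by (simp only: ell2_inner_commute[of "T v"] left_scale)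
    have "\<bar>ell2_inner (T u) (T v)\<bar> \<le> norm u * norm v * (K * K)" for u v
    proof -
      have "\<bar>ell2_inner (T u) (T v)\<bar> \<le> ell2_norm (T u) * ell2_norm (T v)"
        by (intro ell2_Cauchy_Schwarz T_ell2)
      also have "\<dots> \<le> (K * norm u) * (K * norm v)"
        using order_trans[OF ell2_norm_nonneg[OF T_ell2] T_bound]
        by (intro mult_mono T_bound ell2_norm_nonneg T_ell2)
      finally show ?thesis by (simp add: mult_ac)
    qed
    then show "\<exists>K. \<forall>u v. norm (ell2_inner (T u) (T v)) \<le> norm u * norm v * K"
      by auto
  qed
  have lin: "bounded_linear (\<lambda>v. ell2_inner (T v) a)" if a: "a \<in> ell2" for a
  proof (rule bounded_linear_intro)
    show "norm (ell2_inner (T v) a) \<le> norm v * (K * ell2_norm a)" for v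
      using ell2_Cauchy_Schwarz(2)[OF T_ell2[of v] a]
        mult_right_mono[OF T_bound[of v] ell2_norm_nonneg[OF a]]
      by (simp add: mult_ac)
  qed (simp_all add: T_add T_scaleR T_ell2 a ell2_inner_add_left ell2_inner_of_real_left)
  define sol where "sol a p \<longleftrightarrow>
    p \<in> W \<and> (\<forall>v\<in>W. ell2_inner (T v) (T p) = ell2_inner (T v) a)" for a p
  have ex1: "\<exists>!p. sol a p" if a: "a \<in> ell2" for a
    unfolding sol_def
  proof (rule coercive_form_representation[OF bil])
    show "subspace W"
      by (rule subspace_of_csubspace[OF W(1)])
    show "0 < c\<^sup>2"
      using c by simp
    show "c\<^sup>2 * (norm v)\<^sup>2 \<le> ell2_inner (T v) (T v)" if "v \<in> W" for v
      using power_mono[OF T_below[OF that], of 2] c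
      by (simp add: ell2_inner_self T_ell2 power_mult_distrib)
  qed (rule ell2_inner_commute W(2) lin[OF a])+
  define L where "L a = (THE p. sol a p)" for a
  have sol_L: "sol a (L a)" if "a \<in> ell2" for a
    unfolding L_def by (rule theI'[OF ex1[OF that]])
  have L_eq: "L a = p" if "a \<in> ell2" "sol a p" for a p
    using ex1[OF that(1)] sol_L[OF that(1)] that(2) by blast
  show ?thesis
  proof (intro exI[of _ L] conjI ballI allI)
    fix a b assume a: "a \<in> ell2" and b: "b \<in> ell2"
    show "L (\<lambda>j. a j + b j) = L a + L b"
    proof (rule L_eq[OF ell2_triangle(1)[OF a b]])
      have add: "ell2_inner x (\<lambda>j. y j + z j) = ell2_inner x y + ell2_inner x z"
        if "x \<in> ell2" "y \<in> ell2" "z \<in> ell2" for x y z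
        using that by (simp add: ell2_inner_commute[of x] ell2_inner_add_left)
      show "sol (\<lambda>j. a j + b j) (L a + L b)"
        using sol_L[OF a] sol_L[OF b] a b
        by (auto simp: sol_def csubspaceD[OF W(1)] T_add T_ell2 add)
    qed
  next
    fix d a assume a: "a \<in> ell2"
    show "L (\<lambda>j. d * a j) = d *\<^sub>C L a"
    proof (rule L_eq[OF ell2_cmult(1)[OF a]])
      have "ell2_inner (T v) (\<lambda>j. d * T (L a) j) = ell2_inner (T v) (\<lambda>j. d * a j)"
        if v: "v \<in> W" for v
      proof -
        have "ell2_inner (T (cnj d *\<^sub>C v)) (T (L a)) = ell2_inner (T (cnj d *\<^sub>C v)) a"
          using sol_L[OF a] csubspaceD(3)[OF W(1) v] unfolding sol_def by blast
        then show ?thesis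
          by (simp add: T_scaleC ell2_inner_cmult_left)
      qed
      then show "sol (\<lambda>j. d * a j) (d *\<^sub>C L a)"
        using sol_L[OF a] by (auto simp: sol_def csubspaceD[OF W(1)] T_scaleC)
    qed
  next
    fix a assume a: "a \<in> ell2"
    let ?n = "ell2_norm (T (L a))"
    have LW: "L a \<in> W" and "ell2_inner (T (L a)) (T (L a)) = ell2_inner (T (L a)) a"
      using sol_L[OF a] by (auto simp: sol_def)
    then have "?n * ?n \<le> ?n * ell2_norm a"
      using ell2_Cauchy_Schwarz(2)[OF T_ell2[of "L a"] a]
      by (simp add: ell2_inner_self[OF T_ell2] power2_eq_square)
    then have "?n \<le> ell2_norm a"
      using ell2_norm_nonneg[OF T_ell2[of "L a"]] ell2_norm_nonneg[OF a]
      by (cases "?n = 0") auto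
    then show "c * norm (L a) \<le> ell2_norm a"
      using T_below[OF LW] by simp
  next
    fix w assume "w \<in> W"
    then show "L (T w) = w"
      by (intro L_eq T_ell2) (simp add: sol_def)
  qed
qed


section \<open>Limits of rows\<close>

text \<open>
  Norm convergence of the rows forces convergence of every column, so the limit row is computed
  columnwise, which makes its linear dependence on the matrix evident.
\<close>

definition row_limit :: "(nat \<Rightarrow> nat \<Rightarrow> complex) \<Rightarrow> nat \<Rightarrow> complex" where
  "row_limit M j = lim (\<lambda>n. M n j)"

lemma row_limit_eq:
  assumes M: "\<And>n. M n \<in> ell2" and t: "t \<in> ell2"
    and lim: "(\<lambda>n. ell2_norm (\<lambda>j. M n j - t j)) \<longlonglongrightarrow> 0"
  shows "(\<lambda>n. M n j) \<longlonglongrightarrow> t j" and "row_limit M = t"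
proof -
  have conv: "(\<lambda>n. M n j) \<longlonglongrightarrow> t j" for j
  proof (rule LIM_zero_cancel, rule Lim_null_comparison[OF _ lim])
    show "\<forall>\<^sub>F n in sequentially. cmod (M n j - t j) \<le> ell2_norm (\<lambda>j. M n j - t j)"
      using cmod_le_ell2_norm[OF ell2_diff[OF M t]] by simp
  qed
  then show "(\<lambda>n. M n j) \<longlonglongrightarrow> t j" .
  show "row_limit M = t"
    using conv by (auto simp: row_limit_def fun_eq_iff intro: limI)
qed

lemma row_limit:
  assumes M: "M \<in> Bs_space"
  shows "(\<lambda>n. M n j) \<longlonglongrightarrow> row_limit M j" and "row_limit M \<in> ell2"
    and "ell2_norm (row_limit M) \<le> Bs_norm M"
proof -
  have Mn: "M n \<in> ell2" for n
    using M by (auto simp: Bs_space_def)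
  obtain t where t: "t \<in> ell2" and lim: "(\<lambda>n. ell2_norm (\<lambda>j. M n j - t j)) \<longlonglongrightarrow> 0"
    using M by (auto simp: Bs_space_def)
  have eq: "row_limit M = t"
    by (rule row_limit_eq(2)[OF Mn t lim])
  show "(\<lambda>n. M n j) \<longlonglongrightarrow> row_limit M j"
    unfolding eq by (rule row_limit_eq(1)[OF Mn t lim])
  show "row_limit M \<in> ell2"
    by (simp add: eq t)
  have diff: "(\<lambda>j. M n j - t j) \<in> ell2" for n
    by (rule ell2_diff[OF Mn t])
  obtain C where C: "\<And>n. ell2_norm (\<lambda>j. M n j - t j) \<le> C"
    using convergent_imp_Bseq[OF convergentI[OF lim]] unfolding Bseq_def
    by (metis abs_le_D1 real_norm_def)
  have "ell2_norm (M n) \<le> C + ell2_norm t" for n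
    using ell2_triangle(2)[OF diff[of n] t] C[of n] by simp
  then have "bdd_above (range (\<lambda>n. ell2_norm (M n)))"
    by (intro bdd_aboveI2)
  then have row: "ell2_norm (M n) \<le> Bs_norm M" for n
    unfolding Bs_norm_def by (intro cSUP_upper) auto
  have "ell2_norm t \<le> Bs_norm M + ell2_norm (\<lambda>j. M n j - t j)" for n
  proof -
    have "ell2_norm t \<le> ell2_norm (M n) + ell2_norm (\<lambda>j. - 1 * (M n j - t j))"
      using ell2_triangle(2)[OF Mn[of n] ell2_cmult(1)[OF diff[of n], of "- 1"]] by simp
    also have "\<dots> \<le> Bs_norm M + ell2_norm (\<lambda>j. M n j - t j)"
      using row[of n] by (simp only: ell2_cmult(2)[OF diff]) simp
    finally show ?thesis .
  qed
  moreover have "(\<lambda>n. Bs_norm M + ell2_norm (\<lambda>j. M n j - t j)) \<longlonglongrightarrow> Bs_norm M"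
    using tendsto_add[OF tendsto_const lim] by simp
  ultimately show "ell2_norm (row_limit M) \<le> Bs_norm M"
    unfolding eq by (intro LIMSEQ_le_const) auto
qed

lemma row_limit_add:
  assumes "M \<in> Bs_space" "N \<in> Bs_space"
  shows "row_limit (\<lambda>n j. M n j + N n j) = (\<lambda>j. row_limit M j + row_limit N j)"
  using tendsto_add[OF row_limit(1)[OF assms(1)] row_limit(1)[OF assms(2)]]
  by (auto simp: row_limit_def[of "\<lambda>n j. M n j + N n j"] fun_eq_iff intro: limI)

lemma row_limit_cmult:
  assumes "M \<in> Bs_space"
  shows "row_limit (\<lambda>n j. c * M n j) = (\<lambda>j. c * row_limit M j)"
  using tendsto_mult_left[OF row_limit(1)[OF assms]]
  by (auto simp: row_limit_def[of "\<lambda>n j. c * M n j"] fun_eq_iff intro: limI)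


section \<open>Orbits and stable recovery\<close>

lemma orbit_minus_fixed_point:
  fixes A :: "'h::chilbert_space \<Rightarrow> 'h"
  assumes A: "bounded_clinear A" and p: "A p + w = p"
  shows "orbit A x0 w n - p = (A ^^ n) (x0 - p)"
proof (induction n)
  case (Suc n)
  have "orbit A x0 w (Suc n) - p = A (orbit A x0 w n) + w - (A p + w)"
    by (simp add: p)
  also have "\<dots> = A (orbit A x0 w n - p)"
    by (simp add: bounded_clinear_diff[OF A])
  finally show ?case
    by (simp add: Suc.IH)
qed simp

lemma orbit_tendsto_fixed_point:
  fixes A :: "'h::chilbert_space \<Rightarrow> 'h"
  assumes "bounded_clinear A" and "spectral_radius A < 1" and "A p + w = p"
  shows "orbit A x0 w \<longlonglongrightarrow> p"
  using powers_tendsto_zero[OF assms(1,2), of "x0 - p"]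
  by (intro LIM_zero_cancel[of _ p]) (simp add: orbit_minus_fixed_point assms)

lemma bessel_sequence_bound:
  fixes g :: "nat \<Rightarrow> 'h::chilbert_space"
  assumes "bessel_sequence g"
  obtains C where "0 \<le> C" and "\<And>h. (\<lambda>j. cinner h (g j)) \<in> ell2"
    and "\<And>h. ell2_norm (\<lambda>j. cinner h (g j)) \<le> C * norm h"
proof -
  obtain C where s: "\<And>h. summable (\<lambda>j. (cmod (cinner h (g j)))\<^sup>2)"
    and C: "\<And>h. (\<Sum>j. (cmod (cinner h (g j)))\<^sup>2) \<le> C * (norm h)\<^sup>2"
    using assms by (auto simp: bessel_sequence_def)
  show thesis
  proof (rule that)
    show "0 \<le> sqrt \<bar>C\<bar>" by simp
    show "(\<lambda>j. cinner h (g j)) \<in> ell2" for h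
      by (simp add: ell2_def s)
    have "(\<Sum>j. (cmod (cinner h (g j)))\<^sup>2) \<le> (sqrt \<bar>C\<bar> * norm h)\<^sup>2" for h
      using order_trans[OF C[of h] mult_right_mono[OF abs_ge_self]]
      by (simp add: power_mult_distrib)
    then show "ell2_norm (\<lambda>j. cinner h (g j)) \<le> sqrt \<bar>C\<bar> * norm h" for h
      unfolding ell2_norm_def by (intro real_le_lsqrt) auto
  qed
qed

text \<open>
  The stationary orbit \<open>x\<^sub>n = (I - A)\<^sup>-\<^sup>1 w\<close> is available because the initial state is arbitrary. All
  rows of its data matrix coincide, so boundedness of the recovery operator is a lower bound on
  this single row.
\<close>

lemma stably_recoverable_imp_lower_bound:
  fixes A F :: "'h::chilbert_space \<Rightarrow> 'h"
  assumes rec: "stably_recoverable A g W" and right: "\<And>x. F x - A (F x) = x"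
  obtains c where "0 < c" and "\<And>w. w \<in> W \<Longrightarrow> c * norm w \<le> ell2_norm (\<lambda>j. cinner (F w) (g j))"
proof -
  obtain Rec where Rec: "bounded_clinear_Bs Rec"
    and D: "\<And>x0 w. w \<in> W \<Longrightarrow> data_matrix A g x0 w \<in> Bs_space \<and> Rec (data_matrix A g x0 w) = w"
    using rec unfolding stably_recoverable_def by blast
  obtain K where K: "\<And>M. M \<in> Bs_space \<Longrightarrow> norm (Rec M) \<le> K * Bs_norm M"
    using Rec unfolding bounded_clinear_Bs_def by blast
  show thesis
  proof (rule that)
    \<comment> \<open>A bound \<open>K\<close> need not be positive, for instance if \<open>W = {0}\<close>.\<close>
    show "0 < 1 / max K 1" by simp
    fix w assume w: "w \<in> W"
    let ?t = "\<lambda>j. cinner (F w) (g j)"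
    have "orbit A (F w) w n = F w" for n
      using right[of w] by (induction n) (simp_all add: algebra_simps)
    then have M: "data_matrix A g (F w) w = (\<lambda>n. ?t)"
      by (simp add: data_matrix_def)
    have Bs: "(\<lambda>n. ?t) \<in> Bs_space" and "Rec (\<lambda>n. ?t) = w"
      using D[OF w, of "F w"] by (simp_all add: M)
    then have "norm w \<le> K * ell2_norm ?t"
      using K[OF Bs] by (simp add: Bs_norm_def)
    also have "\<dots> \<le> max K 1 * ell2_norm ?t"
      using Bs by (intro mult_right_mono ell2_norm_nonneg) (auto simp: Bs_space_def)
    finally show "1 / max K 1 * norm w \<le> ell2_norm ?t"
      by (simp add: field_simps)
  qed
qed

lemma lower_bound_imp_stably_recoverable:
  fixes A F :: "'h::chilbert_space \<Rightarrow> 'h"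
  assumes W: "csubspace W" "closed W" and g: "bessel_sequence g"
    and A: "bounded_clinear A" "spectral_radius A < 1"
    and F: "bounded_clinear F" and right: "\<And>x. F x - A (F x) = x"
    and c: "0 < c" "\<And>w. w \<in> W \<Longrightarrow> c * norm w \<le> ell2_norm (\<lambda>j. cinner (F w) (g j))"
  shows "stably_recoverable A g W"
proof -
  obtain C where C: "0 \<le> C" and g2: "\<And>h. (\<lambda>j. cinner h (g j)) \<in> ell2"
    and gC: "\<And>h. ell2_norm (\<lambda>j. cinner h (g j)) \<le> C * norm h"
    by (rule bessel_sequence_bound[OF g]) blast
  define T where "T w j = cinner (F w) (g j)" for w j
  have T: "T w = (\<lambda>j. cinner (F w) (g j))" for w
    by (simp add: T_def fun_eq_iff)
  obtain K where K: "\<And>x. norm (F x) \<le> K * norm x"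
    using bounded_clinear_bound[OF F] by blast
  have "\<exists>L. (\<forall>a\<in>ell2. \<forall>b\<in>ell2. L (\<lambda>j. a j + b j) = L a + L b) \<and>
      (\<forall>d. \<forall>a\<in>ell2. L (\<lambda>j. d * a j) = d *\<^sub>C L a) \<and>
      (\<forall>a\<in>ell2. c * norm (L a) \<le> ell2_norm a) \<and> (\<forall>w\<in>W. L (T w) = w)"
  proof (rule bounded_below_imp_left_inverse[OF W, of T])
    show "T (x + y) = (\<lambda>j. T x j + T y j)" for x y
      by (simp add: T bounded_clinear_add[OF F] cinner_add_left)
    show "T (d *\<^sub>C x) = (\<lambda>j. d * T x j)" for d x
      by (simp add: T bounded_clinear_scaleC[OF F] cinner_scaleC_left)
    show "T x \<in> ell2" for x
      by (simp add: T g2)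
    show "ell2_norm (T x) \<le> (C * K) * norm x" for x
      using order_trans[OF gC mult_left_mono[OF K C]] by (simp add: T mult.assoc)
    show "w \<in> W \<Longrightarrow> c * norm w \<le> ell2_norm (T w)" for w
      using c(2) by (simp add: T)
    show "0 < c"
      by (rule c(1))
  qed
  then obtain L where L_add: "\<And>a b. a \<in> ell2 \<Longrightarrow> b \<in> ell2 \<Longrightarrow> L (\<lambda>j. a j + b j) = L a + L b"
    and L_scaleC: "\<And>d a. a \<in> ell2 \<Longrightarrow> L (\<lambda>j. d * a j) = d *\<^sub>C L a"
    and L_bound: "\<And>a. a \<in> ell2 \<Longrightarrow> c * norm (L a) \<le> ell2_norm a"
    and L_T: "\<And>w. w \<in> W \<Longrightarrow> L (T w) = w"
    by blast
  define Rec where "Rec M = L (row_limit M)" for M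
  have "bounded_clinear_Bs Rec"
    unfolding bounded_clinear_Bs_def
  proof (intro conjI ballI allI exI[of _ "1 / c"])
    fix M N assume "M \<in> Bs_space" "N \<in> Bs_space"
    then show "Rec (\<lambda>n j. M n j + N n j) = Rec M + Rec N"
      by (simp add: Rec_def row_limit_add L_add row_limit(2))
  next
    fix d M assume "M \<in> Bs_space"
    then show "Rec (\<lambda>n j. d * M n j) = d *\<^sub>C Rec M"
      by (simp add: Rec_def row_limit_cmult L_scaleC row_limit(2))
  next
    fix M assume M: "M \<in> Bs_space"
    have "c * norm (Rec M) \<le> Bs_norm M"
      using L_bound[OF row_limit(2)[OF M]] row_limit(3)[OF M] by (simp add: Rec_def)
    then show "norm (Rec M) \<le> 1 / c * Bs_norm M"
      using c(1) by (simp add: field_simps)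
  qed
  moreover have "data_matrix A g x0 w \<in> Bs_space \<and> Rec (data_matrix A g x0 w) = w"
    if w: "w \<in> W" for x0 w
  proof -
    let ?M = "data_matrix A g x0 w"
    have "A (F w) + w = F w"
      using right[of w] by (simp add: algebra_simps)
    then have "orbit A x0 w \<longlonglongrightarrow> F w"
      by (rule orbit_tendsto_fixed_point[OF A])
    then have bound0: "(\<lambda>n. C * norm (orbit A x0 w n - F w)) \<longlonglongrightarrow> 0"
      by (intro tendsto_mult_right_zero tendsto_norm_zero LIM_zero)
    have "?M n j - T w j = cinner (orbit A x0 w n - F w) (g j)" for n j
      by (simp add: data_matrix_def T_def cinner_diff_left)
    then have "norm (ell2_norm (\<lambda>j. ?M n j - T w j)) \<le> C * norm (orbit A x0 w n - F w)" for n
      using gC ell2_norm_nonneg[OF g2] by simp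
    then have lim: "(\<lambda>n. ell2_norm (\<lambda>j. ?M n j - T w j)) \<longlonglongrightarrow> 0"
      by (intro Lim_null_comparison[OF always_eventually bound0] allI)
    have rows: "?M n \<in> ell2" for n
      by (simp add: data_matrix_def g2)
    have t: "T w \<in> ell2"
      by (simp add: T g2)
    have "?M \<in> Bs_space"
      using rows t lim by (auto simp: Bs_space_def)
    moreover have "row_limit ?M = T w"
      by (rule row_limit_eq(2)[OF rows t lim])
    ultimately show ?thesis
      by (simp add: Rec_def L_T w)
  qed
  ultimately show ?thesis
    unfolding stably_recoverable_def by blast
qed

lemma frame_for_iff_lower_bound:
  fixes T :: "'h::chilbert_space \<Rightarrow> nat \<Rightarrow> complex"
  assumes f: "range f \<subseteq> W" and T: "\<And>w. w \<in> W \<Longrightarrow> (\<lambda>j. cinner w (f j)) = T w"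
    and T_ell2: "\<And>w. T w \<in> ell2" and T_bound: "\<And>w. ell2_norm (T w) \<le> K * norm w"
  shows "frame_for W f \<longleftrightarrow> (\<exists>c>0. \<forall>w\<in>W. c * norm w \<le> ell2_norm (T w))"
proof
  assume "frame_for W f"
  then obtain c where c: "0 < c"
    and le: "\<And>w. w \<in> W \<Longrightarrow> c * (norm w)\<^sup>2 \<le> (\<Sum>j. (cmod (cinner w (f j)))\<^sup>2)"
    unfolding frame_for_def by blast
  have "sqrt c * norm w \<le> ell2_norm (T w)" if w: "w \<in> W" for w
  proof (rule power2_le_imp_le)
    show "(sqrt c * norm w)\<^sup>2 \<le> (ell2_norm (T w))\<^sup>2"
      using le[OF w] c
      by (simp add: fun_cong[OF T[OF w]] ell2_norm_power2[OF T_ell2] power_mult_distrib)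
  qed (rule ell2_norm_nonneg[OF T_ell2])
  with c show "\<exists>c>0. \<forall>w\<in>W. c * norm w \<le> ell2_norm (T w)"
    by (intro exI[of _ "sqrt c"]) auto
next
  assume "\<exists>c>0. \<forall>w\<in>W. c * norm w \<le> ell2_norm (T w)"
  then obtain c where c: "0 < c" and le: "\<And>w. w \<in> W \<Longrightarrow> c * norm w \<le> ell2_norm (T w)"
    by blast
  \<comment> \<open>The maximum keeps the upper frame bound above the lower one when \<open>W = {0}\<close>.\<close>
  show "frame_for W f"
    unfolding frame_for_def
  proof (rule conjI[OF f], rule exI[of _ "c\<^sup>2"], rule exI[of _ "max (c\<^sup>2) (K\<^sup>2)"],
      intro conjI ballI)
    fix w assume w: "w \<in> W"
    show "summable (\<lambda>j. (cmod (cinner w (f j)))\<^sup>2)"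
      using T_ell2[of w] by (simp add: fun_cong[OF T[OF w]] ell2_def)
    have sum: "(\<Sum>j. (cmod (cinner w (f j)))\<^sup>2) = (ell2_norm (T w))\<^sup>2"
      by (simp add: fun_cong[OF T[OF w]] ell2_norm_power2[OF T_ell2])
    show "c\<^sup>2 * (norm w)\<^sup>2 \<le> (\<Sum>j. (cmod (cinner w (f j)))\<^sup>2)"
      using power_mono[OF le[OF w], of 2] c by (simp add: sum power_mult_distrib)
    have "(ell2_norm (T w))\<^sup>2 \<le> K\<^sup>2 * (norm w)\<^sup>2"
      using power_mono[OF T_bound[of w] ell2_norm_nonneg[OF T_ell2], of 2]
      by (simp add: power_mult_distrib)
    also have "\<dots> \<le> max (c\<^sup>2) (K\<^sup>2) * (norm w)\<^sup>2"
      by (intro mult_right_mono) auto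
    finally show "(\<Sum>j. (cmod (cinner w (f j)))\<^sup>2) \<le> max (c\<^sup>2) (K\<^sup>2) * (norm w)\<^sup>2"
      by (simp add: sum)
  qed (use c in auto)
qed

theorem theorem3p5:
  fixes A :: "'h::chilbert_space \<Rightarrow> 'h"
    and g :: "nat \<Rightarrow> 'h"
    and W :: "'h set"
  assumes "\<exists>D :: 'h set. countable D \<and> closure D = UNIV"
    and "csubspace W" and "closed W"
    and "bessel_sequence g"
    and "bounded_clinear A" and "spectral_radius A < 1"
  shows "stably_recoverable A g W \<longleftrightarrow>
    frame_for W (\<lambda>j. orth_proj W (inv (\<lambda>x. x - cadjoint A x) (g j)))"
proof -
  note W = \<open>csubspace W\<close> \<open>closed W\<close> and g = \<open>bessel_sequence g\<close>
    and A = \<open>bounded_clinear A\<close> \<open>spectral_radius A < 1\<close>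
  have "1 \<notin> cspectrum A"
    using cmod_le_spectral_radius[OF A(1), of 1] A(2) by auto
  then obtain F where F: "bounded_clinear F"
    and left: "\<And>x. F (x - A x) = x" and right: "\<And>x. F x - A (F x) = x"
    by (auto simp: cspectrum_def)
  obtain C where C: "0 \<le> C" and g2: "\<And>h. (\<lambda>j. cinner h (g j)) \<in> ell2"
    and gC: "\<And>h. ell2_norm (\<lambda>j. cinner h (g j)) \<le> C * norm h"
    by (rule bessel_sequence_bound[OF g]) blast
  obtain K where K: "\<And>x. norm (F x) \<le> K * norm x"
    using bounded_clinear_bound[OF F] by blast
  let ?f = "\<lambda>j. orth_proj W (inv (\<lambda>x. x - cadjoint A x) (g j))"
  have "frame_for W ?f \<longleftrightarrow>
      (\<exists>c>0. \<forall>w\<in>W. c * norm w \<le> ell2_norm (\<lambda>j. cinner (F w) (g j)))"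
  proof (rule frame_for_iff_lower_bound)
    show "range ?f \<subseteq> W"
      using orth_proj(1)[OF W] by blast
    show "(\<lambda>j. cinner w (?f j)) = (\<lambda>j. cinner (F w) (g j))" if "w \<in> W" for w
      using that
      by (simp add: orth_proj(2)[OF W] cinner_inv_id_minus_cadjoint[OF A(1) F left right])
    show "ell2_norm (\<lambda>j. cinner (F w) (g j)) \<le> (C * K) * norm w" for w
      using order_trans[OF gC mult_left_mono[OF K C]] by (simp add: mult.assoc)
  qed (rule g2)
  also have "\<dots> \<longleftrightarrow> stably_recoverable A g W"
    using stably_recoverable_imp_lower_bound[where F = F, OF _ right]
      lower_bound_imp_stably_recoverable[OF W g A F right]
    by metis
  finally show ?thesis by simp
qed

end
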